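(* Let $d_1,d_2,k\in\mathbb{N}$. Let $\mathcal{EB}_k(d_1,d_2)$ be the set of all $k$-entanglement breaking linear maps from $\mathbb{M}_{d_1}$ into $\mathbb{M}_{d_2}$, and let $\mathcal{EBCP}_k(d_1,d_2)$ be the set of all $k$-entanglement breaking completely positive maps from $\mathbb{M}_{d_1}$ into $\mathbb{M}_{d_2}$. Then both $\mathcal{EB}_k(d_1,d_2)$ and $\mathcal{EBCP}_k(d_1,d_2)$ are mapping cones.
   Context: $\mathbb{M}_d$ is the algebra of complex $d\times d$ matrices; a superscript $+$ denotes the cone of positive semidefinite matrices. A linear map $\Phi:\mathbb{M}_{d_1}\to\mathbb{M}_{d_2}$ is positive if it maps $\mathbb{M}_{d_1}^+$ into $\mathbb{M}_{d_2}^+$, $k$-positive if $\mathrm{id}_k\otimes\Phi$ is positive, and completely positive (CP) if it is $k$-positive for all $k\geq 1$. $X\in(\mathbb{M}_{m}\otimes\mathbb{M}_{n})^+$ is separable if $X=\sum_i A_i\otimes B_i$ (finite sum) with $A_i\in\mathbb{M}_m^+$, $B_i\in\mathbb{M}_n^+$. $\Phi$ is $k$-entanglement breaking if it is $k$-positive and $(\mathrm{id}_k\otimes\Phi)(X)$ is separable for every $X\in(\mathbb{M}_k\otimes\mathbb{M}_{d_1})^+$. Let $\mathcal{P}(d_1,d_2)$ be the cone of all positive linear maps $\mathbb{M}_{d_1}\to\mathbb{M}_{d_2}$. A mapping cone is a closed convex cone $\mathscr{C}\subseteq\mathcal{P}(d_1,d_2)$ such that $\Phi\circ\Theta\circ\Psi\in\mathscr{C}$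 for all $\Theta\in\mathscr{C}$ and all CP-maps $\Psi:\mathbb{M}_{d_1}\to\mathbb{M}_{d_1}$ and $\Phi:\mathbb{M}_{d_2}\to\mathbb{M}_{d_2}$. *)

theory Defs
  imports "HOL-Analysis.Function_Topology" "Jordan_Normal_Form.Conjugate" "Jordan_Normal_Form.Matrix"
begin

text \<open>
  The algebra of complex \<open>d \<times> d\<close> matrices is \<^term>\<open>carrier_mat d d :: complex mat set\<close>.  The tensor
  product of the \<open>m \<times> m\<close> and the \<open>n \<times> n\<close> matrices is identified with the \<open>m * n \<times> m * n\<close>
  matrices in the usual way (Kronecker product): the pair of indices \<open>(i, a)\<close> becomes
  \<open>i * n + a\<close>.
\<close>

text \<open>
  In the order of \<^theory>\<open>HOL-Library.Complex_Order\<close>, \<open>0 \<le> z\<close> says that \<open>z\<close> is real and nonnegative,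
  so Hermiticity is included below.
\<close>

definition psd :: "nat \<Rightarrow> complex mat set" where
  "psd d = {X \<in> carrier_mat d d. \<forall>v \<in> carrier_vec d. 0 \<le> (X *\<^sub>v v) \<bullet>c v}"

text \<open>
  Linear maps are extensional (\<^const>\<open>undefined\<close> off the carrier), so that two linear maps are
  equal as soon as they agree on all \<open>d\<^sub>1 \<times> d\<^sub>1\<close> matrices.
\<close>

definition linear_maps :: "nat \<Rightarrow> nat \<Rightarrow> (complex mat \<Rightarrow> complex mat) set" where
  "linear_maps d\<^sub>1 d\<^sub>2 = {\<Phi> \<in> carrier_mat d\<^sub>1 d\<^sub>1 \<rightarrow>\<^sub>E carrier_mat d\<^sub>2 d\<^sub>2.
     (\<forall>X \<in> carrier_mat d\<^sub>1 d\<^sub>1. \<forall>Y \<in> carrier_mat d\<^sub>1 d\<^sub>1. \<Phi> (X + Y) = \<Phi> X + \<Phi> Y) \<and>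
     (\<forall>c. \<forall>X \<in> carrier_mat d\<^sub>1 d\<^sub>1. \<Phi> (c \<cdot>\<^sub>m X) = c \<cdot>\<^sub>m \<Phi> X)}"

definition linmap_add :: "nat \<Rightarrow> (complex mat \<Rightarrow> complex mat) \<Rightarrow> (complex mat \<Rightarrow> complex mat)
    \<Rightarrow> complex mat \<Rightarrow> complex mat" where
  "linmap_add d\<^sub>1 \<Phi> \<Psi> = (\<lambda>X \<in> carrier_mat d\<^sub>1 d\<^sub>1. \<Phi> X + \<Psi> X)"

definition linmap_scale :: "nat \<Rightarrow> real \<Rightarrow> (complex mat \<Rightarrow> complex mat) \<Rightarrow> complex mat \<Rightarrow> complex mat" where
  "linmap_scale d\<^sub>1 t \<Phi> = (\<lambda>X \<in> carrier_mat d\<^sub>1 d\<^sub>1. complex_of_real t \<cdot>\<^sub>m \<Phi> X)"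

text \<open>
  The topology of entrywise pointwise convergence, which is the only Hausdorff vector space
  topology on this finite-dimensional space.
\<close>

definition linear_maps_topology :: "nat \<Rightarrow> nat \<Rightarrow> (complex mat \<Rightarrow> complex mat) topology" where
  "linear_maps_topology d\<^sub>1 d\<^sub>2 =
     (let I = carrier_mat d\<^sub>1 d\<^sub>1 \<times> {..<d\<^sub>2} \<times> {..<d\<^sub>2}
      in pullback_topology (linear_maps d\<^sub>1 d\<^sub>2)
           (\<lambda>\<Phi>. \<lambda>(X, i, j) \<in> I. \<Phi> X $$ (i, j)) (product_topology (\<lambda>_. euclidean) I))"

definition tensor_mat :: "complex mat \<Rightarrow> complex mat \<Rightarrow> complex mat" where
  "tensor_mat A B = mat (dim_row A * dim_row B) (dim_col A * dim_col B)
     (\<lambda>(r, s). A $$ (r div dim_row B, s div dim_col B) * B $$ (r mod dim_row B, s mod dim_col B))"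

text \<open>\<open>block n X i j\<close> is the block of \<open>X\<close> at the matrix unit \<open>E\<^sub>i\<^sub>j\<close> of the left tensor factor.\<close>

definition block :: "nat \<Rightarrow> complex mat \<Rightarrow> nat \<Rightarrow> nat \<Rightarrow> complex mat" where
  "block n X i j = mat n n (\<lambda>(a, b). X $$ (i * n + a, j * n + b))"

text \<open>
  \<open>ampliation k d\<^sub>1 d\<^sub>2 \<Phi>\<close> is \<open>id\<^sub>k \<otimes> \<Phi>\<close>, i.e. \<open>\<Phi>\<close> applied to each block; see \<open>ampliation_tensor\<close> and
  \<open>ampliation_linear\<close> below.
\<close>

definition ampliation :: "nat \<Rightarrow> nat \<Rightarrow> nat \<Rightarrow> (complex mat \<Rightarrow> complex mat) \<Rightarrow> complex mat \<Rightarrow> complex mat" where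
  "ampliation k d\<^sub>1 d\<^sub>2 \<Phi> = (\<lambda>X \<in> carrier_mat (k * d\<^sub>1) (k * d\<^sub>1).
     mat (k * d\<^sub>2) (k * d\<^sub>2)
       (\<lambda>(r, s). \<Phi> (block d\<^sub>1 X (r div d\<^sub>2) (s div d\<^sub>2)) $$ (r mod d\<^sub>2, s mod d\<^sub>2)))"

definition positive_maps :: "nat \<Rightarrow> nat \<Rightarrow> (complex mat \<Rightarrow> complex mat) set" where
  "positive_maps d\<^sub>1 d\<^sub>2 = {\<Phi> \<in> linear_maps d\<^sub>1 d\<^sub>2. \<forall>X \<in> psd d\<^sub>1. \<Phi> X \<in> psd d\<^sub>2}"

definition k_positive_maps :: "nat \<Rightarrow> nat \<Rightarrow> nat \<Rightarrow> (complex mat \<Rightarrow> complex mat) set" where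
  "k_positive_maps k d\<^sub>1 d\<^sub>2 =
     {\<Phi> \<in> linear_maps d\<^sub>1 d\<^sub>2. ampliation k d\<^sub>1 d\<^sub>2 \<Phi> \<in> positive_maps (k * d\<^sub>1) (k * d\<^sub>2)}"

definition CP_maps :: "nat \<Rightarrow> nat \<Rightarrow> (complex mat \<Rightarrow> complex mat) set" where
  "CP_maps d\<^sub>1 d\<^sub>2 = {\<Phi> \<in> linear_maps d\<^sub>1 d\<^sub>2. \<forall>k\<ge>1. \<Phi> \<in> k_positive_maps k d\<^sub>1 d\<^sub>2}"

text \<open>
  The finite sum of the matrices \<open>A l \<otimes> B l\<close> is written entrywise, because matrices of
  unspecified dimension have no zero to sum from.
\<close>

definition separable :: "nat \<Rightarrow> nat \<Rightarrow> complex mat set" where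
  "separable m n = {X \<in> psd (m * n). \<exists>(N::nat) A B.
     (\<forall>l<N. A l \<in> psd m \<and> B l \<in> psd n) \<and>
     X = mat (m * n) (m * n) (\<lambda>rs. \<Sum>l<N. tensor_mat (A l) (B l) $$ rs)}"

definition EB :: "nat \<Rightarrow> nat \<Rightarrow> nat \<Rightarrow> (complex mat \<Rightarrow> complex mat) set" where
  "EB k d\<^sub>1 d\<^sub>2 = {\<Phi> \<in> k_positive_maps k d\<^sub>1 d\<^sub>2.
     \<forall>X \<in> psd (k * d\<^sub>1). ampliation k d\<^sub>1 d\<^sub>2 \<Phi> X \<in> separable k d\<^sub>2}"

definition EBCP :: "nat \<Rightarrow> nat \<Rightarrow> nat \<Rightarrow> (complex mat \<Rightarrow> complex mat) set" where
  "EBCP k d\<^sub>1 d\<^sub>2 = EB k d\<^sub>1 d\<^sub>2 \<inter> CP_maps d\<^sub>1 d\<^sub>2"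

definition convex_cone_of_maps :: "nat \<Rightarrow> (complex mat \<Rightarrow> complex mat) set \<Rightarrow> bool" where
  "convex_cone_of_maps d\<^sub>1 C \<longleftrightarrow> C \<noteq> {} \<and>
     (\<forall>\<Phi>\<in>C. \<forall>t\<ge>0. linmap_scale d\<^sub>1 t \<Phi> \<in> C) \<and>
     (\<forall>\<Phi>\<in>C. \<forall>\<Psi>\<in>C. \<forall>s\<ge>0. \<forall>t\<ge>0. s + t = 1 \<longrightarrow>
        linmap_add d\<^sub>1 (linmap_scale d\<^sub>1 s \<Phi>) (linmap_scale d\<^sub>1 t \<Psi>) \<in> C)"

definition mapping_cone :: "nat \<Rightarrow> nat \<Rightarrow> (complex mat \<Rightarrow> complex mat) set \<Rightarrow> bool" where
  "mapping_cone d\<^sub>1 d\<^sub>2 C \<longleftrightarrow>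
     C \<subseteq> positive_maps d\<^sub>1 d\<^sub>2 \<and>
     closedin (linear_maps_topology d\<^sub>1 d\<^sub>2) C \<and>
     convex_cone_of_maps d\<^sub>1 C \<and>
     (\<forall>\<Theta>\<in>C. \<forall>\<Psi> \<in> CP_maps d\<^sub>1 d\<^sub>1. \<forall>\<Phi> \<in> CP_maps d\<^sub>2 d\<^sub>2.
        compose (carrier_mat d\<^sub>1 d\<^sub>1) \<Phi> (compose (carrier_mat d\<^sub>1 d\<^sub>1) \<Theta> \<Psi>) \<in> C)"

lemma index_less_mult:
  fixes i k n a :: nat
  assumes "i < k" "a < n"
  shows "i * n + a < k * n"
proof -
  have "i * n + a < i * n + n" using assms by simp
  also have "\<dots> = (i + 1) * n" by simp
  also have "\<dots> \<le> k * n" using assms by (intro mult_le_mono1) simp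
  finally show ?thesis .
qed

lemma block_tensor:
  assumes A: "A \<in> carrier_mat k k" and B: "B \<in> carrier_mat n n" and ij: "i < k" "j < k"
  shows "block n (tensor_mat A B) i j = A $$ (i, j) \<cdot>\<^sub>m B"
proof (rule eq_matI)
  fix a b assume "a < dim_row (A $$ (i, j) \<cdot>\<^sub>m B)" "b < dim_col (A $$ (i, j) \<cdot>\<^sub>m B)"
  then have ab: "a < n" "b < n" using B by auto
  have "i * n + a < k * n" "j * n + b < k * n" using ij ab by (auto intro: index_less_mult)
  then show "block n (tensor_mat A B) i j $$ (a, b) = (A $$ (i, j) \<cdot>\<^sub>m B) $$ (a, b)"
    using A B ij ab by (simp add: block_def tensor_mat_def)
qed (use B in \<open>auto simp: block_def\<close>)

lemma ampliation_tensor: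
  assumes \<Phi>: "\<Phi> \<in> linear_maps d\<^sub>1 d\<^sub>2" and A: "A \<in> carrier_mat k k" and B: "B \<in> carrier_mat d\<^sub>1 d\<^sub>1"
  shows "ampliation k d\<^sub>1 d\<^sub>2 \<Phi> (tensor_mat A B) = tensor_mat A (\<Phi> B)"
proof -
  have \<Phi>B: "\<Phi> B \<in> carrier_mat d\<^sub>2 d\<^sub>2" using \<Phi> B by (auto simp: linear_maps_def)
  have T: "tensor_mat A B \<in> carrier_mat (k * d\<^sub>1) (k * d\<^sub>1)" using A B by (auto simp: tensor_mat_def)
  show ?thesis
  proof (rule eq_matI)
    fix r s assume "r < dim_row (tensor_mat A (\<Phi> B))" "s < dim_col (tensor_mat A (\<Phi> B))"
    then have rs: "r < k * d\<^sub>2" "s < k * d\<^sub>2" using A \<Phi>B by (auto simp: tensor_mat_def)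
    then have pos: "d\<^sub>2 > 0" by (cases d\<^sub>2) auto
    have dv: "r div d\<^sub>2 < k" "s div d\<^sub>2 < k" using rs by (simp_all add: less_mult_imp_div_less)
    have "\<Phi> (A $$ (r div d\<^sub>2, s div d\<^sub>2) \<cdot>\<^sub>m B) = A $$ (r div d\<^sub>2, s div d\<^sub>2) \<cdot>\<^sub>m \<Phi> B"
      using \<Phi> B by (auto simp: linear_maps_def)
    then show "ampliation k d\<^sub>1 d\<^sub>2 \<Phi> (tensor_mat A B) $$ (r, s) = tensor_mat A (\<Phi> B) $$ (r, s)"
      using T rs pos A \<Phi>B block_tensor[OF A B dv]
      unfolding ampliation_def tensor_mat_def[of A "\<Phi> B"] by simp
  qed (use T A \<Phi>B in \<open>auto simp: ampliation_def tensor_mat_def\<close>)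
qed

lemma ampliation_linear:
  assumes \<Phi>: "\<Phi> \<in> linear_maps d\<^sub>1 d\<^sub>2"
  shows "ampliation k d\<^sub>1 d\<^sub>2 \<Phi> \<in> linear_maps (k * d\<^sub>1) (k * d\<^sub>2)"
proof -
  have bc: "block n X i j \<in> carrier_mat n n" for n X i j by (simp add: block_def)
  have car: "\<Phi> (block d\<^sub>1 X i j) \<in> carrier_mat d\<^sub>2 d\<^sub>2" for X i j
    using \<Phi> bc by (auto simp: linear_maps_def)
  have badd: "block d\<^sub>1 (X + Y) i j = block d\<^sub>1 X i j + block d\<^sub>1 Y i j"
    and bscale: "block d\<^sub>1 (c \<cdot>\<^sub>m X) i j = c \<cdot>\<^sub>m block d\<^sub>1 X i j"
    if "X \<in> carrier_mat (k * d\<^sub>1) (k * d\<^sub>1)" "Y \<in> carrier_mat (k * d\<^sub>1) (k * d\<^sub>1)" "i < k" "j < k"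
    for X Y i j c
    using that by (auto simp: block_def index_less_mult intro!: eq_matI)
  have L1: "\<Phi> (block d\<^sub>1 X i j + block d\<^sub>1 Y i j) = \<Phi> (block d\<^sub>1 X i j) + \<Phi> (block d\<^sub>1 Y i j)" for X Y i j
    using \<Phi> bc by (auto simp: linear_maps_def)
  have L2: "\<Phi> (c \<cdot>\<^sub>m block d\<^sub>1 X i j) = c \<cdot>\<^sub>m \<Phi> (block d\<^sub>1 X i j)" for c X i j
    using \<Phi> bc by (auto simp: linear_maps_def)
  have dv: "r div d\<^sub>2 < k" "r mod d\<^sub>2 < d\<^sub>2" if "r < k * d\<^sub>2" for r
  proof -
    have "d\<^sub>2 > 0" using that by (cases d\<^sub>2) auto
    then show "r div d\<^sub>2 < k" "r mod d\<^sub>2 < d\<^sub>2" using that by (simp_all add: less_mult_imp_div_less)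
  qed
  have cd: "dim_row (\<Phi> (block d\<^sub>1 X i j)) = d\<^sub>2" "dim_col (\<Phi> (block d\<^sub>1 X i j)) = d\<^sub>2" for X i j
    using car[of X i j] by auto
  show ?thesis
    unfolding linear_maps_def
    by (auto simp: ampliation_def badd bscale L1 L2 dv cd intro!: eq_matI)
qed

end

theory Submission
  imports
    Defs
    "HOL-Analysis.Topology_Euclidean_Space"
    "HOL-Analysis.Function_Metric"
begin

hide_const (open) Finite_Cartesian_Product.mat Finite_Cartesian_Product.row Finite_Cartesian_Product.vec

text \<open>
  Being \<open>k\<close>-entanglement breaking means that \<open>id\<^sub>k \<otimes> \<Phi>\<close> maps positive semidefinite matrices into the cone
  of separable matrices; being completely positive means that every \<open>id\<^sub>l \<otimes> \<Phi>\<close> maps them into the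
  positive semidefinite cone. As \<open>id\<^sub>k \<otimes> \<Phi>\<close> depends linearly and continuously on \<open>\<Phi>\<close>, such a condition
  defines a closed convex cone of maps as soon as the target is a closed convex cone of matrices
  (\<open>closedin_ampliated_into\<close>, \<open>map_cone_ampliated_into\<close>), and both properties survive intersections.

  The analytic core is that the separable matrices are closed (\<open>closed_separable_form\<close>). Two bounds lead
  to a compactness argument. By Caratheodory's theorem for cones (\<open>conic_Caratheodory\<close>), a separable
  matrix is a sum of a number of products \<open>A \<otimes> B\<close> that depends only on the dimensions. The factors can be
  scaled such that the trace of \<open>A\<close> is at most \<open>1\<close> and that of \<open>B\<close> at most the trace of the whole matrix
  (\<open>kron_normalise\<close>), and the entries of a positive semidefinite matrix are bounded by its trace
  (\<open>psd_form_norm_le_trace\<close>). Hence the separable matrices of bounded trace come from a compact set of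
  tuples of factors, and closedness follows because compact sets have compact images.

  For compositions with completely positive maps, \<open>id\<^sub>k \<otimes> (\<Phi> \<circ> \<Theta> \<circ> \<Psi>)\<close> is the composition of the three
  ampliations. The first one preserves positive semidefiniteness, the second one produces a separable
  matrix, and the last one keeps it separable, since it acts on the second tensor factors alone and
  \<open>\<Phi>\<close> is positive (\<open>ampliation_separable\<close>).
\<close>

section \<open>Caratheodory's theorem for cones\<close>

text \<open>
  Gaussian elimination, as an induction over the set \<open>I\<close> of equations: an unknown \<open>p\<close> with a nonzero
  coefficient in the equation \<open>i\<close> is eliminated from all other equations, the smaller system is solved
  without \<open>p\<close>, and the value at \<open>p\<close> is then forced by the equation \<open>i\<close>.
\<close>

lemma homogeneous_system_nontrivial_solution:
  fixes x :: "'l \<Rightarrow> 'i \<Rightarrow> real"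
  assumes "finite I" "finite L" "card I < card L"
  shows "\<exists>c. (\<exists>l\<in>L. c l \<noteq> 0) \<and> (\<forall>i\<in>I. (\<Sum>l\<in>L. c l * x l i) = 0)"
  using assms
proof (induction I arbitrary: L x rule: finite_induct)
  case empty
  then show ?case by (intro exI[of _ "\<lambda>_. 1"]) (auto simp: card_gt_0_iff)
next
  case (insert i I)
  show ?case
  proof (cases "\<forall>l\<in>L. x l i = 0")
    case True
    have "card I < card L" using insert by simp
    from insert.IH[OF insert.prems(1) this] obtain c where
      "\<exists>l\<in>L. c l \<noteq> 0" "\<forall>j\<in>I. (\<Sum>l\<in>L. c l * x l j) = 0" by blast
    with True show ?thesis by (intro exI[of _ c]) auto
  next
    case False
    then obtain p where p: "p \<in> L" "x p i \<noteq> 0" by auto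
    define y where "y l j = x l j - x l i / x p i * x p j" for l j
    have "card I < card (L - {p})" using insert p by simp
    from insert.IH[OF _ this, of y] insert.prems obtain c where
      c: "\<exists>l\<in>L-{p}. c l \<noteq> 0" "\<forall>j\<in>I. (\<Sum>l\<in>L-{p}. c l * y l j) = 0" by auto
    define e where "e = c(p := - (\<Sum>l\<in>L-{p}. c l * x l i) / x p i)"
    have e: "(\<Sum>l\<in>L. e l * x l j) = (\<Sum>l\<in>L-{p}. c l * y l j)" for j
    proof -
      have "(\<Sum>l\<in>L. e l * x l j) = e p * x p j + (\<Sum>l\<in>L-{p}. e l * x l j)"
        using insert.prems p by (simp add: sum.remove)
      also have "(\<Sum>l\<in>L-{p}. e l * x l j) = (\<Sum>l\<in>L-{p}. c l * x l j)"
        by (intro sum.cong) (auto simp: e_def)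
      also have "e p * x p j = - (\<Sum>l\<in>L-{p}. c l * (x l i / x p i * x p j))"
        by (simp add: e_def sum_distrib_right sum_divide_distrib sum_negf mult.assoc)
      finally show ?thesis
        by (simp add: y_def right_diff_distrib sum_subtractf)
    qed
    have "(\<Sum>l\<in>L. e l * x l i) = 0"
      unfolding e using p by (simp add: y_def)
    moreover have "\<exists>l\<in>L. e l \<noteq> 0" using c(1) by (auto simp: e_def)
    ultimately show ?thesis using c(2) by (intro exI[of _ e]) (simp add: e)
  qed
qed

text \<open>
  As long as there are more vectors than coordinates, a linear dependence \<open>c\<close> allows one of them to be
  dropped: the dependence is subtracted with the factor \<open>1 / Max (c ` L)\<close>, the largest one that keeps
  all weights nonnegative, and then the weight at which the maximum is attained vanishes.
\<close>

lemma conic_Caratheodory: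
  fixes x :: "'l \<Rightarrow> 'i \<Rightarrow> real"
  assumes "finite I" "finite L"
  shows "\<exists>L'\<subseteq>L. card L' \<le> card I \<and>
           (\<exists>t. (\<forall>l. 0 \<le> t l) \<and> (\<forall>i\<in>I. (\<Sum>l\<in>L'. t l * x l i) = (\<Sum>l\<in>L. x l i)))"
  using assms(2)
proof (induction "card L" arbitrary: L x rule: less_induct)
  case less
  show ?case
  proof (cases "card L \<le> card I")
    case True
    then show ?thesis by (intro exI[of _ L]) (auto intro!: exI[of _ "\<lambda>_. 1"])
  next
    case False
    then obtain c0 where c0: "\<exists>l\<in>L. c0 l \<noteq> 0" "\<forall>i\<in>I. (\<Sum>l\<in>L. c0 l * x l i) = 0"
      using homogeneous_system_nontrivial_solution[OF assms(1) less.prems, of x]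
      by (auto simp: not_le)
    \<comment> \<open>Up to its sign, the dependence has a positive coefficient.\<close>
    obtain c where c: "\<exists>l\<in>L. c l > 0" "\<forall>i\<in>I. (\<Sum>l\<in>L. c l * x l i) = (0::real)"
    proof (cases "\<exists>l\<in>L. c0 l > 0")
      case True
      with c0 that show ?thesis by blast
    next
      case False
      with c0 show ?thesis
        by (intro that[of "\<lambda>l. - c0 l"]) (force simp: sum_negf not_less less_le)+
    qed
    define m where "m = Max (c ` L)"
    have mge: "c l \<le> m" if "l \<in> L" for l using that less.prems by (simp add: m_def)
    then have m: "m > 0" using c(1) by fastforce
    have "m \<in> c ` L" unfolding m_def using c(1) less.prems by (intro Max_in) auto
    then obtain p where p: "p \<in> L" "c p = m" by auto
    \<comment> \<open>The maximum with \<open>0\<close> has an effect only off \<open>L\<close>; it makes \<open>s\<close> nonnegative everywhere.\<close>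
    define s where "s l = max 0 (1 - c l / m)" for l
    have s: "s l = 1 - c l / m" if "l \<in> L" for l
      using mge[OF that] m by (simp add: s_def)
    have sum_s: "(\<Sum>l\<in>L-{p}. s l * x l i) = (\<Sum>l\<in>L. x l i)" if "i \<in> I" for i
    proof -
      have "(\<Sum>l\<in>L. s l * x l i) = (\<Sum>l\<in>L. x l i) - (\<Sum>l\<in>L. c l * x l i) / m"
        by (simp add: s left_diff_distrib sum_subtractf sum_divide_distrib cong: sum.cong)
      moreover have "s p = 0" using p s m by simp
      ultimately show ?thesis using c(2) that p less.prems by (simp add: sum.remove)
    qed
    have "card (L - {p}) < card L" using p less.prems by (intro card_Diff1_less)
    from less.hyps[OF this, of "\<lambda>l i. s l * x l i"] less.prems obtain L' t where
      L': "L' \<subseteq> L - {p}" "card L' \<le> card I" "\<forall>l. 0 \<le> t l"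
        "\<forall>i\<in>I. (\<Sum>l\<in>L'. t l * (s l * x l i)) = (\<Sum>l\<in>L-{p}. s l * x l i)"
      by auto
    have "\<forall>l. 0 \<le> t l * s l" using L'(3) by (simp add: s_def)
    then show ?thesis using L' sum_s
      by (intro exI[of _ L'] conjI exI[of _ "\<lambda>l. t l * s l"]) (auto simp: mult.assoc)
  qed
qed

section \<open>Positive semidefinite forms\<close>

text \<open>
  Positive semidefiniteness of the upper left \<open>d \<times> d\<close> corner of an infinite array. Arrays, unlike
  matrices of unspecified dimension, form a type with a topology (the product topology), so
  closedness and compactness can be stated with the type class notions.
\<close>

definition psd_form :: "nat \<Rightarrow> (nat \<times> nat \<Rightarrow> complex) \<Rightarrow> bool" where
  "psd_form d f \<longleftrightarrow> (\<forall>z. 0 \<le> (\<Sum>i<d. \<Sum>j<d. f (i, j) * z j * cnj (z i)))"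

lemma psd_iff_psd_form: "X \<in> psd d \<longleftrightarrow> X \<in> carrier_mat d d \<and> psd_form d (\<lambda>rs. X $$ rs)"
proof -
  have eq: "(X *\<^sub>v v) \<bullet>c v = (\<Sum>i<d. \<Sum>j<d. X $$ (i, j) * v $ j * cnj (v $ i))"
    if "X \<in> carrier_mat d d" "v \<in> carrier_vec d" for v
    using that unfolding scalar_prod_def mult_mat_vec_def
    by (auto simp: sum_distrib_right lessThan_atLeast0 scalar_prod_def intro!: sum.cong)
  show ?thesis
  proof (cases "X \<in> carrier_mat d d")
    case True
    have "psd_form d (\<lambda>rs. X $$ rs)" if H: "\<forall>v\<in>carrier_vec d. 0 \<le> (X *\<^sub>v v) \<bullet>c v"
      unfolding psd_form_def
    proof
      fix z
      have "0 \<le> (X *\<^sub>v vec d z) \<bullet>c vec d z" using H by simp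
      also have "\<dots> = (\<Sum>i<d. \<Sum>j<d. X $$ (i, j) * z j * cnj (z i))"
        by (subst eq[OF True]) auto
      finally show "0 \<le> (\<Sum>i<d. \<Sum>j<d. X $$ (i, j) * z j * cnj (z i))" .
    qed
    then show ?thesis using True unfolding psd_def psd_form_def by (auto simp: eq)
  qed (simp add: psd_def)
qed

lemma mat_in_psd_iff: "mat d d f \<in> psd d \<longleftrightarrow> psd_form d f"
  unfolding psd_iff_psd_form psd_form_def by simp

lemma psd_carrier: "X \<in> psd d \<Longrightarrow> X \<in> carrier_mat d d"
  by (simp add: psd_def)

lemma psd_form_principal:
  assumes f: "psd_form n f" and h: "inj_on h {..<m}" "h ` {..<m} \<subseteq> {..<n}"
  shows "psd_form m (\<lambda>(i, j). f (h i, h j))"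
  unfolding psd_form_def
proof
  fix z :: "nat \<Rightarrow> complex"
  define w where "w a = (if a \<in> h ` {..<m} then z (inv_into {..<m} h a) else 0)" for a
  have "0 \<le> (\<Sum>a<n. \<Sum>b<n. f (a, b) * w b * cnj (w a))" using f by (simp add: psd_form_def)
  also have "\<dots> = (\<Sum>a\<in>h`{..<m}. \<Sum>b\<in>h`{..<m}. f (a, b) * w b * cnj (w a))"
    using h(2) by (intro sum.mono_neutral_cong_right sum.neutral) (auto simp: w_def)
  also have "\<dots> = (\<Sum>i<m. \<Sum>j<m. f (h i, h j) * w (h j) * cnj (w (h i)))"
    using h(1) by (simp add: sum.reindex)
  also have "\<dots> = (\<Sum>i<m. \<Sum>j<m. f (h i, h j) * z j * cnj (z i))"
    using h(1) by (intro sum.cong refl) (auto simp: w_def)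
  finally show "0 \<le> (\<Sum>i<m. \<Sum>j<m. (case (i, j) of (i, j) \<Rightarrow> f (h i, h j)) * z j * cnj (z i))"
    by simp
qed

lemma psd_form_diag:
  assumes "psd_form n f" "i < n"
  shows "0 \<le> f (i, i)"
proof -
  have "psd_form 1 (\<lambda>(a, b). f ((\<lambda>_. i) a, (\<lambda>_. i) b))"
    using assms by (intro psd_form_principal) (auto simp: inj_on_def)
  then show ?thesis unfolding psd_form_def by (auto dest: spec[of _ "\<lambda>_. 1"])
qed

text \<open>
  For \<open>w\<close> on the unit circle, the form at the vector \<open>(1, w)\<close> is the sum of the diagonal entries plus
  \<open>2 Re (f (0, 1) w)\<close>; the phase of \<open>w\<close> is chosen such that the last term is \<open>- 2 |f (0, 1)|\<close>.
  The points \<open>1\<close> and \<open>\<i>\<close> first show that the form is Hermitian.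
\<close>

lemma psd_form_2x2_norm_le:
  assumes "psd_form 2 f"
  shows "2 * cmod (f (0, 1)) \<le> Re (f (0, 0)) + Re (f (1, 1))"
proof -
  have q: "0 \<le> f (0,0) * z 0 * cnj (z 0) + f (0,1) * z 1 * cnj (z 0)
      + f (1,0) * z 0 * cnj (z 1) + f (1,1) * z 1 * cnj (z 1)" for z :: "nat \<Rightarrow> complex"
    using assms[unfolded psd_form_def, rule_format, of z]
    by (simp add: numeral_2_eq_2 add.assoc add.commute add.left_commute)
  have q1: "0 \<le> f (0,0) + f (0,1) * w + f (1,0) * cnj w + f (1,1) * (w * cnj w)" for w
    using q[of "\<lambda>i. if i = 0 then 1 else w"] by (simp add: mult.assoc)
  have d: "Im (f (0,0)) = 0" "Im (f (1,1)) = 0"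
    using psd_form_diag[OF assms, of 0] psd_form_diag[OF assms, of 1]
    by (simp_all add: less_eq_complex_def)
  have herm: "f (1,0) = cnj (f (0,1))"
    using q1[of 1] q1[of \<i>] d by (simp add: less_eq_complex_def complex_eq_iff)
  show ?thesis
  proof (cases "f (0,1) = 0")
    case True
    then show ?thesis using psd_form_diag[OF assms, of 0] psd_form_diag[OF assms, of 1]
      by (simp add: less_eq_complex_def)
  next
    case False
    define u where "u = - cnj (f (0,1)) / cmod (f (0,1))"
    have nz: "cmod (f (0,1)) \<noteq> 0" using False by simp
    have sq: "f (0,1) * cnj (f (0,1)) = complex_of_real (cmod (f (0,1))) * complex_of_real (cmod (f (0,1)))"
      by (simp flip: complex_norm_square add: power2_eq_square)
    have u1: "u * cnj u = 1"
      using nz sq by (simp add: u_def field_simps)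
    have u2: "f (0,1) * u = - cmod (f (0,1))"
      using nz sq by (simp add: u_def field_simps)
    have u3: "f (1,0) * cnj u = - cmod (f (0,1))"
      using u2 by (metis herm complex_cnj_mult complex_cnj_minus complex_cnj_complex_of_real)
    have "0 \<le> f (0,0) + - cmod (f (0,1)) + - cmod (f (0,1)) + f (1,1)"
      using q1[of u] unfolding u1 u2 u3 by simp
    then show ?thesis by (simp add: less_eq_complex_def)
  qed
qed

lemma psd_form_norm_le:
  assumes "psd_form n f" "i < n" "j < n"
  shows "2 * cmod (f (i, j)) \<le> Re (f (i, i)) + Re (f (j, j))"
proof (cases "i = j")
  case True
  have "0 \<le> f (i, i)" using psd_form_diag[OF assms(1,2)] .
  then show ?thesis using True by (simp add: less_eq_complex_def cmod_eq_Re)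
next
  case False
  have "psd_form 2 (\<lambda>(a, b). f ((\<lambda>a. if a = 0 then i else j) a, (\<lambda>a. if a = 0 then i else j) b))"
    using assms False by (intro psd_form_principal) (auto simp: inj_on_def less_2_cases_iff)
  from psd_form_2x2_norm_le[OF this] show ?thesis by simp
qed

lemma psd_form_add: "psd_form d f \<Longrightarrow> psd_form d g \<Longrightarrow> psd_form d (\<lambda>rs. f rs + g rs)"
  unfolding psd_form_def by (simp add: distrib_right sum.distrib add_nonneg_nonneg)

lemma psd_form_scale:
  assumes "psd_form d f" "0 \<le> t"
  shows "psd_form d (\<lambda>rs. complex_of_real t * f rs)"
proof -
  have "(\<Sum>i<d. \<Sum>j<d. complex_of_real t * f (i, j) * z j * cnj (z i)) =
        complex_of_real t * (\<Sum>i<d. \<Sum>j<d. f (i, j) * z j * cnj (z i))" for z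
    by (simp add: sum_distrib_left mult.assoc)
  moreover have "0 \<le> complex_of_real t" using assms by (simp add: less_eq_complex_def)
  ultimately show ?thesis using assms(1)
    unfolding psd_form_def by (simp only: mult_nonneg_nonneg simp_thms)
qed

lemma psd_form_cong:
  assumes "\<And>i j. i < d \<Longrightarrow> j < d \<Longrightarrow> f (i, j) = g (i, j)"
  shows "psd_form d f \<longleftrightarrow> psd_form d g"
proof -
  have "(\<Sum>i<d. \<Sum>j<d. f (i, j) * z j * cnj (z i)) = (\<Sum>i<d. \<Sum>j<d. g (i, j) * z j * cnj (z i))" for z
    using assms by (intro sum.cong) auto
  then show ?thesis unfolding psd_form_def by simp
qed

lemma closed_psd_form: "closed {f. psd_form d f}"
proof -
  have "continuous_on UNIV (\<lambda>f::nat\<times>nat\<Rightarrow>complex. \<Sum>i<d. \<Sum>j<d. f (i, j) * z j * cnj (z i))" for z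
    by (intro continuous_on_sum continuous_on_mult continuous_on_const continuous_on_product_coordinates)
  then have "closed {f::nat\<times>nat\<Rightarrow>complex. 0 \<le> Re (\<Sum>i<d. \<Sum>j<d. f (i, j) * z j * cnj (z i)) \<and>
      0 = Im (\<Sum>i<d. \<Sum>j<d. f (i, j) * z j * cnj (z i))}" for z
    by (intro closed_Collect_conj closed_Collect_le closed_Collect_eq continuous_intros
        continuous_on_product_coordinates)
  then show ?thesis unfolding psd_form_def less_eq_complex_def
    by (intro closed_Collect_all) simp
qed

section \<open>Separable matrices form a closed set\<close>

text \<open>
  The counterpart of \<^const>\<open>tensor_mat\<close> for arrays. The pair encoding of indices involves the size of the
  right factor only, so the size of the left one is not a parameter.
\<close>

definition kron :: "nat \<Rightarrow> (nat \<times> nat \<Rightarrow> complex) \<Rightarrow> (nat \<times> nat \<Rightarrow> complex) \<Rightarrow> nat \<times> nat \<Rightarrow> complex" where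
  "kron n f g = (\<lambda>(r, s). f (r div n, s div n) * g (r mod n, s mod n))"

text \<open>
  Only the decomposition part of separability; it is handled apart from the semidefiniteness of \<open>F\<close>.
\<close>

definition separable_form :: "nat \<Rightarrow> nat \<Rightarrow> (nat \<times> nat \<Rightarrow> complex) \<Rightarrow> bool" where
  "separable_form m n F \<longleftrightarrow> (\<exists>(N::nat) f g. (\<forall>l<N. psd_form m (f l) \<and> psd_form n (g l)) \<and>
     (\<forall>r<m*n. \<forall>s<m*n. F (r, s) = (\<Sum>l<N. kron n (f l) (g l) (r, s))))"

lemma div_mod_less:
  fixes r :: nat
  assumes "r < m * n"
  shows "r div n < m" "r mod n < n"
proof -
  have "n > 0" using assms by (cases n) auto
  then show "r div n < m" "r mod n < n" using assms by (simp_all add: less_mult_imp_div_less)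
qed

lemma tensor_mat_index:
  assumes "A \<in> carrier_mat m m" "B \<in> carrier_mat n n" "r < m * n" "s < m * n"
  shows "tensor_mat A B $$ (r, s) = kron n (\<lambda>rs. A $$ rs) (\<lambda>rs. B $$ rs) (r, s)"
  using assms by (simp add: tensor_mat_def kron_def)

lemma separable_iff: "X \<in> separable m n \<longleftrightarrow> X \<in> psd (m * n) \<and> separable_form m n (\<lambda>rs. X $$ rs)"
proof
  assume X: "X \<in> separable m n"
  then obtain N A B where N: "X \<in> psd (m * n)" "\<forall>l<N. A l \<in> psd m \<and> B l \<in> psd n"
    "X = mat (m * n) (m * n) (\<lambda>rs. \<Sum>l<(N::nat). tensor_mat (A l) (B l) $$ rs)"
    unfolding separable_def by blast
  have "X $$ (r, s) = (\<Sum>l<N. kron n (\<lambda>rs. A l $$ rs) (\<lambda>rs. B l $$ rs) (r, s))"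
    if "r < m * n" "s < m * n" for r s
    using N(2) that by (subst N(3)) (auto intro!: sum.cong tensor_mat_index psd_carrier)
  then show "X \<in> psd (m * n) \<and> separable_form m n (\<lambda>rs. X $$ rs)"
    using N(1,2) unfolding separable_form_def psd_iff_psd_form
    by (intro conjI exI[of _ N] exI[of _ "\<lambda>l rs. A l $$ rs"] exI[of _ "\<lambda>l rs. B l $$ rs"]) auto
next
  assume X: "X \<in> psd (m * n) \<and> separable_form m n (\<lambda>rs. X $$ rs)"
  then obtain N f g where N: "\<forall>l<N. psd_form m (f l) \<and> psd_form n (g l)"
    "\<forall>r<m*n. \<forall>s<m*n. X $$ (r, s) = (\<Sum>l<(N::nat). kron n (f l) (g l) (r, s))"
    unfolding separable_form_def by blast
  have "X $$ (r, s) = (\<Sum>l<N. tensor_mat (mat m m (f l)) (mat n n (g l)) $$ (r, s))"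
    if "r < m * n" "s < m * n" for r s
    using N(2) that div_mod_less[OF that(1)] div_mod_less[OF that(2)]
    by (subst tensor_mat_index) (auto simp: kron_def)
  then have "X = mat (m * n) (m * n) (\<lambda>rs. \<Sum>l<N. tensor_mat (mat m m (f l)) (mat n n (g l)) $$ rs)"
    using X psd_carrier[of X "m * n"] by (intro eq_matI) auto
  moreover have "\<forall>l<N. mat m m (f l) \<in> psd m \<and> mat n n (g l) \<in> psd n"
    using N(1) by (simp add: mat_in_psd_iff)
  ultimately show "X \<in> separable m n" using X unfolding separable_def
    by (intro CollectI conjI exI[of _ N] exI[of _ "\<lambda>l. mat m m (f l)"] exI[of _ "\<lambda>l. mat n n (g l)"]) auto
qed

text \<open>
  The trace controls every entry: a bound on the trace keeps the \<open>n \<times> n\<close> corner in a compact set.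
\<close>

lemma psd_form_norm_le_trace:
  assumes "psd_form n f" "i < n" "j < n"
  shows "cmod (f (i, j)) \<le> (\<Sum>l<n. Re (f (l, l)))"
proof -
  have nn: "0 \<le> Re (f (l, l))" if "l < n" for l
    using psd_form_diag[OF assms(1) that] by (simp add: less_eq_complex_def)
  have "Re (f (l, l)) \<le> (\<Sum>l<n. Re (f (l, l)))" if "l < n" for l
    using nn that by (intro member_le_sum[of l "{..<n}" "\<lambda>l. Re (f (l, l))"]) auto
  from this[OF assms(2)] this[OF assms(3)] psd_form_norm_le[OF assms] show ?thesis by simp
qed

text \<open>
  The real part of the trace over \<open>\<complex>\<^sup>m \<otimes> \<complex>\<^sup>n\<close>, summed along the two tensor factors so that it factorizes
  on Kronecker products.
\<close>

definition trace_tensor :: "nat \<Rightarrow> nat \<Rightarrow> (nat \<times> nat \<Rightarrow> complex) \<Rightarrow> real" where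
  "trace_tensor m n F = (\<Sum>i<m. \<Sum>a<n. Re (F (i * n + a, i * n + a)))"

lemma trace_tensor_kron:
  assumes "psd_form m f" "psd_form n g"
  shows "trace_tensor m n (kron n f g) = (\<Sum>i<m. Re (f (i, i))) * (\<Sum>a<n. Re (g (a, a)))"
proof -
  have "trace_tensor m n (kron n f g) = (\<Sum>i<m. \<Sum>a<n. Re (f (i, i)) * Re (g (a, a)))"
    using assms[THEN psd_form_diag] unfolding trace_tensor_def
    by (intro sum.cong refl) (auto simp: kron_def less_eq_complex_def)
  then show ?thesis by (simp add: sum_product)
qed

text \<open>
  Since the bound is imposed on all entries of the two arrays, also on those outside the relevant
  corners, this is a compact set by Tychonoff's theorem.
\<close>

definition bounded_factors :: "nat \<Rightarrow> nat \<Rightarrow> real \<Rightarrow> ((nat \<times> nat \<Rightarrow> complex) \<times> (nat \<times> nat \<Rightarrow> complex)) set" where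
  "bounded_factors m n C =
     ({f. \<forall>rs. f rs \<in> cball 0 C} \<inter> {f. psd_form m f}) \<times> ({g. \<forall>rs. g rs \<in> cball 0 C} \<inter> {g. psd_form n g})"

lemma zero_in_bounded_factors: "0 \<le> C \<Longrightarrow> (\<lambda>_. 0, \<lambda>_. 0) \<in> bounded_factors m n C"
  by (auto simp: bounded_factors_def psd_form_def)

text \<open>
  A product does not bound its factors. Moving the trace \<open>\<tau>\<close> of \<open>f\<close>, together with the weight \<open>t\<close>, into the
  second factor makes the first trace \<open>1\<close> and the second one the trace of the whole product. If \<open>\<tau> = 0\<close>, then
  the corner of \<open>f\<close> is zero and so is the product.
\<close>

lemma kron_normalise:
  assumes f: "psd_form m f" and g: "psd_form n g" and t: "0 \<le> t"
    and C: "1 \<le> C" "t * trace_tensor m n (kron n f g) \<le> C"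
  shows "\<exists>q\<in>bounded_factors m n C. \<forall>r<m*n. \<forall>s<m*n.
           kron n (fst q) (snd q) (r, s) = t * kron n f g (r, s)"
proof -
  define \<tau> where "\<tau> = (\<Sum>i<m. Re (f (i, i)))"
  have \<tau>0: "0 \<le> \<tau>" unfolding \<tau>_def using psd_form_diag[OF f]
    by (intro sum_nonneg) (auto simp: less_eq_complex_def)
  have fb: "cmod (f (i, j)) \<le> \<tau>" if "i < m" "j < m" for i j
    unfolding \<tau>_def using psd_form_norm_le_trace[OF f that] .
  show ?thesis
  proof (cases "\<tau> = 0")
    case True
    have "kron n f g (r, s) = 0" if "r < m * n" "s < m * n" for r s
      using fb[of "r div n" "s div n"] True div_mod_less[OF that(1)] div_mod_less[OF that(2)]
      by (simp add: kron_def)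
    moreover have "(\<lambda>_. 0, \<lambda>_. 0) \<in> bounded_factors m n C"
      using C by (intro zero_in_bounded_factors) simp
    ultimately show ?thesis by (intro bexI[of _ "(\<lambda>_. 0, \<lambda>_. 0)"]) (auto simp: kron_def)
  next
    case False
    with \<tau>0 have \<tau>: "0 < \<tau>" by simp
    define f' where "f' = (\<lambda>(i, j). if i < m \<and> j < m then complex_of_real (1 / \<tau>) * f (i, j) else 0)"
    define g' where "g' = (\<lambda>(a, b). if a < n \<and> b < n then complex_of_real (t * \<tau>) * g (a, b) else 0)"
    have "psd_form m f'"
      using psd_form_scale[OF f, of "1 / \<tau>"] \<tau>
      by (subst psd_form_cong[of _ _ "\<lambda>rs. complex_of_real (1 / \<tau>) * f rs"]) (auto simp: f'_def)
    moreover have "psd_form n g'"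
      using psd_form_scale[OF g, of "t * \<tau>"] \<tau> t
      by (subst psd_form_cong[of _ _ "\<lambda>rs. complex_of_real (t * \<tau>) * g rs"]) (auto simp: g'_def)
    moreover have "cmod (f' rs) \<le> C" for rs
    proof (cases rs)
      case (Pair i j)
      have "cmod (f (i, j)) / \<tau> \<le> C" if "i < m" "j < m"
        using fb[OF that] \<tau> C(1) by (smt (verit) divide_le_eq_1_pos)
      then show ?thesis using \<tau> C(1) by (auto simp: f'_def Pair norm_mult norm_divide)
    qed
    moreover have "cmod (g' rs) \<le> C" for rs
    proof (cases rs)
      case (Pair a b)
      show ?thesis
      proof (cases "a < n \<and> b < n")
        case True
        then have "cmod (g' rs) = t * \<tau> * cmod (g (a, b))"
          using t \<tau> by (simp add: g'_def Pair norm_mult)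
        also have "\<dots> \<le> t * \<tau> * (\<Sum>a<n. Re (g (a, a)))"
          using True t \<tau> by (intro mult_left_mono psd_form_norm_le_trace g) auto
        also have "\<dots> = t * trace_tensor m n (kron n f g)"
          by (simp add: trace_tensor_kron[OF f g] \<tau>_def)
        finally show ?thesis using C by simp
      qed (use C in \<open>auto simp: g'_def Pair\<close>)
    qed
    moreover have "kron n f' g' (r, s) = t * kron n f g (r, s)" if "r < m * n" "s < m * n" for r s
      using \<tau> div_mod_less[OF that(1)] div_mod_less[OF that(2)]
      by (simp add: kron_def f'_def g'_def)
    ultimately show ?thesis
      by (intro bexI[of _ "(f', g')"]) (auto simp: bounded_factors_def)
  qed
qed

text \<open>
  The number of product terms is bounded by the real dimension \<open>2 (m n)\<^sup>2\<close> of the matrix space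
  (Caratheodory), and each term has a nonnegative trace, hence one that is at most the trace of \<open>F\<close>. So
  the decompositions of all \<open>F\<close> with trace at most \<open>C\<close> can be taken from one compact set.
\<close>

lemma separable_form_bounded_factors:
  assumes "separable_form m n F" and C: "1 \<le> C" "trace_tensor m n F \<le> C"
  shows "\<exists>p \<in> UNIV \<rightarrow> bounded_factors m n C. \<forall>r<m*n. \<forall>s<m*n.
           F (r, s) = (\<Sum>l<2*(m*n)\<^sup>2. kron n (fst (p l)) (snd (p l)) (r, s))"
proof -
  obtain N f g where N: "\<forall>l<N. psd_form m (f l) \<and> psd_form n (g l)"
    and F: "\<And>r s. r < m*n \<Longrightarrow> s < m*n \<Longrightarrow> F (r, s) = (\<Sum>l<(N::nat). kron n (f l) (g l) (r, s))"
    using assms(1) unfolding separable_form_def by blast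
  \<comment> \<open>The real coordinates of an array: the real and imaginary parts of its entries.\<close>
  define I where "I = ({..<m*n} \<times> {..<m*n}) \<times> (UNIV :: bool set)"
  have I: "finite I" "card I = 2*(m*n)\<^sup>2"
    by (simp_all add: I_def card_cartesian_product power2_eq_square)
  define x where "x l = (\<lambda>(rs, b). if b then Re (kron n (f l) (g l) rs) else Im (kron n (f l) (g l) rs))" for l
  from conic_Caratheodory[OF I(1) finite_lessThan[of N], of x] obtain L t where
    L: "L \<subseteq> {..<N}" "card L \<le> card I" "\<forall>l. 0 \<le> t l"
      "\<forall>i\<in>I. (\<Sum>l\<in>L. t l * x l i) = (\<Sum>l<N. x l i)"
    by blast
  have finL: "finite L" using L(1) finite_subset by blast
  have FL: "F (r, s) = (\<Sum>l\<in>L. t l * kron n (f l) (g l) (r, s))" if "r < m * n" "s < m * n" for r s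
    using L(4)[rule_format, of "((r, s), True)"] L(4)[rule_format, of "((r, s), False)"] F[OF that] that
    by (simp add: I_def x_def complex_eq_iff)
  have tr: "trace_tensor m n F = (\<Sum>l\<in>L. t l * trace_tensor m n (kron n (f l) (g l)))"
  proof -
    have "trace_tensor m n F = (\<Sum>i<m. \<Sum>a<n. \<Sum>l\<in>L. t l * Re (kron n (f l) (g l) (i * n + a, i * n + a)))"
      unfolding trace_tensor_def by (intro sum.cong refl) (simp add: FL index_less_mult)
    also have "\<dots> = (\<Sum>l\<in>L. \<Sum>i<m. \<Sum>a<n. t l * Re (kron n (f l) (g l) (i * n + a, i * n + a)))"
    proof -
      have "(\<Sum>a<n. \<Sum>l\<in>L. t l * Re (kron n (f l) (g l) (i * n + a, i * n + a))) =
          (\<Sum>l\<in>L. \<Sum>a<n. t l * Re (kron n (f l) (g l) (i * n + a, i * n + a)))" for i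
        by (rule sum.swap)
      then show ?thesis by (simp only:) (rule sum.swap)
    qed
    finally show ?thesis by (simp add: trace_tensor_def sum_distrib_left)
  qed
  have "t l * trace_tensor m n (kron n (f l) (g l)) \<le> C" if "l \<in> L" for l
  proof -
    have "0 \<le> t l * trace_tensor m n (kron n (f l) (g l))" if "l \<in> L" for l
      using N L(1,3) that psd_form_diag[of m "f l"] psd_form_diag[of n "g l"]
      by (subst trace_tensor_kron)
         (auto simp: less_eq_complex_def intro!: mult_nonneg_nonneg sum_nonneg)
    then have "t l * trace_tensor m n (kron n (f l) (g l)) \<le> trace_tensor m n F"
      unfolding tr using that finL by (intro member_le_sum) auto
    then show ?thesis using C by simp
  qed
  then have "\<forall>l\<in>L. \<exists>q\<in>bounded_factors m n C. \<forall>r<m*n. \<forall>s<m*n.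
      kron n (fst q) (snd q) (r, s) = t l * kron n (f l) (g l) (r, s)"
    using N L(1,3) C(1) by (intro ballI kron_normalise) auto
  then obtain q where q: "\<And>l. l \<in> L \<Longrightarrow> q l \<in> bounded_factors m n C"
    "\<And>l r s. l \<in> L \<Longrightarrow> r < m * n \<Longrightarrow> s < m * n \<Longrightarrow>
      kron n (fst (q l)) (snd (q l)) (r, s) = t l * kron n (f l) (g l) (r, s)"
    by metis
  obtain h where h: "bij_betw h {..<card L} L"
    using ex_bij_betw_nat_finite[OF finL] by (auto simp: atLeast0LessThan)
  \<comment> \<open>Zero products fill the sum up to the fixed number of terms.\<close>
  define p where "p j = (if j < card L then q (h j) else (\<lambda>_. 0, \<lambda>_. 0))" for j
  have "p \<in> UNIV \<rightarrow> bounded_factors m n C"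
    using q(1) bij_betwE[OF h] zero_in_bounded_factors[of C m n] C(1) by (auto simp: p_def)
  moreover have "F (r, s) = (\<Sum>l<2*(m*n)\<^sup>2. kron n (fst (p l)) (snd (p l)) (r, s))"
    if "r < m * n" "s < m * n" for r s
  proof -
    have "F (r, s) = (\<Sum>l\<in>L. kron n (fst (q l)) (snd (q l)) (r, s))"
      using FL[OF that] q(2) that by simp
    also have "\<dots> = (\<Sum>j<card L. kron n (fst (q (h j))) (snd (q (h j))) (r, s))"
      by (rule sum.reindex_bij_betw[OF h, symmetric])
    also have "\<dots> = (\<Sum>l<2*(m*n)\<^sup>2. kron n (fst (p l)) (snd (p l)) (r, s))"
      using L(2) I(2) by (intro sum.mono_neutral_cong_left) (auto simp: p_def kron_def)
    finally show ?thesis .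
  qed
  ultimately show ?thesis by blast
qed

lemma compact_Pi_UNIV:
  fixes S :: "'i \<Rightarrow> 'a::topological_space set"
  assumes "\<And>i. compact (S i)"
  shows "compact {f. \<forall>i. f i \<in> S i}"
proof -
  have "compactin (product_topology (\<lambda>_. euclidean) UNIV) (PiE UNIV S)"
    using assms by (simp add: compactin_PiE)
  moreover have "PiE UNIV S = {f. \<forall>i. f i \<in> S i}" by auto
  ultimately show ?thesis by (simp add: euclidean_product_topology)
qed

lemma compact_bounded_factors: "compact (bounded_factors m n C)"
  unfolding bounded_factors_def
  by (intro compact_Times compact_Int_closed compact_Pi_UNIV closed_psd_form compact_cball)

text \<open>
  The traces of a convergent sequence are bounded by some \<open>C\<close>. So all its members, with their
  irrelevant entries set to zero by \<open>R\<close>, lie in the image of a compact set of tuples of bounded factors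
  under the continuous map \<open>G\<close>. The image is compact, hence closed, and contains the limit.
\<close>

lemma closed_separable_form: "closed {F. separable_form m n F}"
proof -
  define D where "D = 2*(m*n)\<^sup>2"
  define R :: "(nat \<times> nat \<Rightarrow> complex) \<Rightarrow> nat \<times> nat \<Rightarrow> complex" where
    "R F = (\<lambda>(r, s). if r < m*n \<and> s < m*n then F (r, s) else 0)" for F
  define G where "G p = R (\<lambda>rs. \<Sum>l<D. kron n (fst (p l)) (snd (p l)) rs)" for p :: "nat \<Rightarrow> _"
  have contR: "continuous_on UNIV (\<lambda>x. R (H x))"
    if "\<And>rs. continuous_on UNIV (\<lambda>x. H x rs)" for H :: "'x::topological_space \<Rightarrow> _"
  proof (rule continuous_on_coordinatewise_then_product)
    fix rs show "continuous_on UNIV (\<lambda>x. R (H x) rs)"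
      using that by (cases "fst rs < m*n \<and> snd rs < m*n") (auto simp: R_def split_beta)
  qed
  have contG: "continuous_on UNIV G"
    unfolding G_def
  proof (rule contR)
    fix rs
    have pr: "continuous_on UNIV (\<lambda>p :: nat \<Rightarrow> (nat \<times> nat \<Rightarrow> complex) \<times> (nat \<times> nat \<Rightarrow> complex). p l)" for l
      by (rule continuous_on_product_coordinates)
    have "continuous_on UNIV (\<lambda>p :: nat \<Rightarrow> (nat \<times> nat \<Rightarrow> complex) \<times> (nat \<times> nat \<Rightarrow> complex). fst (p l) ij)"
      "continuous_on UNIV (\<lambda>p :: nat \<Rightarrow> (nat \<times> nat \<Rightarrow> complex) \<times> (nat \<times> nat \<Rightarrow> complex). snd (p l) ij)" for l ij
      by (rule continuous_on_product_then_coordinatewise[OF continuous_on_fst[OF pr]]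
               continuous_on_product_then_coordinatewise[OF continuous_on_snd[OF pr]])+
    then show "continuous_on UNIV (\<lambda>p. \<Sum>l<D. kron n (fst (p l)) (snd (p l)) rs)"
      by (cases rs) (auto simp: kron_def intro!: continuous_on_sum continuous_on_mult)
  qed
  have clG: "closed (G ` (UNIV \<rightarrow> bounded_factors m n C))" for C
  proof -
    have "UNIV \<rightarrow> bounded_factors m n C = {p :: nat \<Rightarrow> _. \<forall>l. p l \<in> bounded_factors m n C}" by auto
    then have "compact ((UNIV :: nat set) \<rightarrow> bounded_factors m n C)"
      by (simp add: compact_Pi_UNIV compact_bounded_factors)
    then show ?thesis
      by (intro compact_imp_closed compact_continuous_image continuous_on_subset[OF contG]) auto
  qed
  have sepG: "separable_form m n F" if "R F \<in> G ` (UNIV \<rightarrow> bounded_factors m n C)" for F C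
  proof -
    from that obtain p where p: "p \<in> UNIV \<rightarrow> bounded_factors m n C" "R F = G p" by auto
    have "F (r, s) = (\<Sum>l<D. kron n (fst (p l)) (snd (p l)) (r, s))" if "r < m*n" "s < m*n" for r s
      using fun_cong[OF p(2), of "(r, s)"] that by (simp add: G_def R_def)
    moreover have "psd_form m (fst (p l)) \<and> psd_form n (snd (p l))" for l
      using p(1) by (cases "p l") (auto simp: bounded_factors_def Pi_iff dest: spec[of _ l])
    ultimately show ?thesis unfolding separable_form_def
      by (intro exI[of _ D] exI[of _ "\<lambda>l. fst (p l)"] exI[of _ "\<lambda>l. snd (p l)"]) simp
  qed
  show ?thesis
    unfolding closed_sequential_limits
  proof (intro allI impI, elim conjE)
    fix Fs F assume Fs: "\<forall>k. Fs k \<in> {F. separable_form m n F}" and lim: "Fs \<longlonglongrightarrow> F"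
    have "continuous_on UNIV (trace_tensor m n)"
      unfolding trace_tensor_def
      by (intro continuous_on_sum continuous_on_Re continuous_on_product_coordinates)
    then have "(\<lambda>k. trace_tensor m n (Fs k)) \<longlonglongrightarrow> trace_tensor m n F"
      using lim by (rule continuous_on_tendsto_compose) auto
    then have "Bseq (\<lambda>k. trace_tensor m n (Fs k))" by (intro convergent_imp_Bseq convergentI)
    then obtain B where B: "\<forall>k. norm (trace_tensor m n (Fs k)) \<le> B"
      unfolding Bseq_def by blast
    define C where "C = max 1 B"
    have "R (Fs k) \<in> G ` (UNIV \<rightarrow> bounded_factors m n C)" for k
    proof -
      have "1 \<le> C" "trace_tensor m n (Fs k) \<le> C" using B[rule_format, of k] by (auto simp: C_def)
      with Fs obtain p where "p \<in> UNIV \<rightarrow> bounded_factors m n C"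
        "\<forall>r<m*n. \<forall>s<m*n. Fs k (r, s) = (\<Sum>l<D. kron n (fst (p l)) (snd (p l)) (r, s))"
        using separable_form_bounded_factors[of m n "Fs k" C] unfolding D_def by blast
      then show ?thesis by (intro image_eqI[of _ _ p]) (auto simp: G_def R_def)
    qed
    moreover have "continuous_on UNIV R"
      using contR[of "\<lambda>F. F"] by (simp add: continuous_on_product_coordinates)
    then have "(\<lambda>k. R (Fs k)) \<longlonglongrightarrow> R F" using lim by (rule continuous_on_tendsto_compose) auto
    ultimately have "R F \<in> G ` (UNIV \<rightarrow> bounded_factors m n C)"
      using clG[of C, unfolded closed_sequential_limits, rule_format, of "\<lambda>k. R (Fs k)" "R F"] by simp
    then show "F \<in> {F. separable_form m n F}" using sepG by simp
  qed
qed

lemma separable_form_add: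
  assumes "separable_form m n F" "separable_form m n H"
  shows "separable_form m n (\<lambda>rs. F rs + H rs)"
proof -
  have sum_split: "(\<Sum>l<N+M. if l < N then u l else v (l - N)) = (\<Sum>l<N. u l) + (\<Sum>l<M. v l)"
    for u v :: "nat \<Rightarrow> complex" and N M :: nat
    by (induction M) (auto simp: add.assoc)
  obtain N f g where N: "\<forall>l<N. psd_form m (f l) \<and> psd_form n (g l)"
    "\<forall>r<m*n. \<forall>s<m*n. F (r, s) = (\<Sum>l<(N::nat). kron n (f l) (g l) (r, s))"
    using assms(1) unfolding separable_form_def by blast
  obtain M f' g' where M: "\<forall>l<M. psd_form m (f' l) \<and> psd_form n (g' l)"
    "\<forall>r<m*n. \<forall>s<m*n. H (r, s) = (\<Sum>l<(M::nat). kron n (f' l) (g' l) (r, s))"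
    using assms(2) unfolding separable_form_def by blast
  define a where "a l = (if l < N then f l else f' (l - N))" for l
  define b where "b l = (if l < N then g l else g' (l - N))" for l
  have "(\<Sum>l<N+M. kron n (a l) (b l) rs) =
      (\<Sum>l<N+M. if l < N then kron n (f l) (g l) rs else kron n (f' (l - N)) (g' (l - N)) rs)" for rs
    by (intro sum.cong) (auto simp: a_def b_def)
  then have "(\<Sum>l<N+M. kron n (a l) (b l) rs) =
      (\<Sum>l<N. kron n (f l) (g l) rs) + (\<Sum>l<M. kron n (f' l) (g' l) rs)" for rs
    using sum_split[of N "\<lambda>l. kron n (f l) (g l) rs" "\<lambda>l. kron n (f' l) (g' l) rs" M] by simp
  then have "\<forall>r<m*n. \<forall>s<m*n. F (r, s) + H (r, s) = (\<Sum>l<N+M. kron n (a l) (b l) (r, s))"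
    using N(2) M(2) by simp
  moreover have "\<forall>l<N+M. psd_form m (a l) \<and> psd_form n (b l)"
    using N(1) M(1) by (auto simp: a_def b_def)
  ultimately show ?thesis unfolding separable_form_def by blast
qed

lemma separable_form_scale:
  assumes "separable_form m n F" "0 \<le> t"
  shows "separable_form m n (\<lambda>rs. complex_of_real t * F rs)"
proof -
  obtain N f g where N: "\<forall>l<N. psd_form m (f l) \<and> psd_form n (g l)"
    "\<forall>r<m*n. \<forall>s<m*n. F (r, s) = (\<Sum>l<(N::nat). kron n (f l) (g l) (r, s))"
    using assms(1) unfolding separable_form_def by blast
  then show ?thesis unfolding separable_form_def
    by (intro exI[of _ N] exI[of _ "\<lambda>l rs. complex_of_real t * f l rs"] exI[of _ g])
       (auto simp: sum_distrib_left kron_def psd_form_scale[OF _ assms(2)] mult.assoc)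
qed

section \<open>Closed cones of matrices\<close>

text \<open>
  The two cones to which the arguments about maps apply are those of the positive semidefinite and of the
  separable matrices. Closedness is stated for arrays, by pulling \<open>S\<close> back along \<^term>\<open>mat n n\<close>.
\<close>

definition closed_matrix_cone :: "nat \<Rightarrow> complex mat set \<Rightarrow> bool" where
  "closed_matrix_cone n S \<longleftrightarrow> S \<subseteq> carrier_mat n n \<and> 0\<^sub>m n n \<in> S \<and>
     (\<forall>X\<in>S. \<forall>Y\<in>S. X + Y \<in> S) \<and> (\<forall>t\<ge>0. \<forall>X\<in>S. complex_of_real t \<cdot>\<^sub>m X \<in> S) \<and>
     closed {F. mat n n F \<in> S}"

lemma closed_matrix_cone_psd: "closed_matrix_cone n (psd n)"
proof -
  have "X + Y \<in> psd n" if "X \<in> psd n" "Y \<in> psd n" for X Y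
  proof -
    have "psd_form n (\<lambda>rs. (X + Y) $$ rs) \<longleftrightarrow> psd_form n (\<lambda>rs. X $$ rs + Y $$ rs)"
      using that[THEN psd_carrier] by (intro psd_form_cong) auto
    then show ?thesis using that by (auto simp: psd_iff_psd_form psd_form_add)
  qed
  moreover have "complex_of_real t \<cdot>\<^sub>m X \<in> psd n" if "X \<in> psd n" "0 \<le> t" for X t
  proof -
    have "psd_form n (\<lambda>rs. (complex_of_real t \<cdot>\<^sub>m X) $$ rs) \<longleftrightarrow> psd_form n (\<lambda>rs. complex_of_real t * X $$ rs)"
      using that(1)[THEN psd_carrier] by (intro psd_form_cong) auto
    then show ?thesis using that by (auto simp: psd_iff_psd_form psd_form_scale)
  qed
  moreover have "0\<^sub>m n n \<in> psd n"
    by (auto simp: psd_iff_psd_form psd_form_def)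
  ultimately show ?thesis
    using psd_carrier closed_psd_form by (auto simp: closed_matrix_cone_def mat_in_psd_iff)
qed

lemma separable_form_cong:
  assumes "\<And>r s. r < m * n \<Longrightarrow> s < m * n \<Longrightarrow> F (r, s) = H (r, s)"
  shows "separable_form m n F \<longleftrightarrow> separable_form m n H"
  unfolding separable_form_def using assms by simp

lemma closed_matrix_cone_separable: "closed_matrix_cone (m * n) (separable m n)"
proof -
  note psd = closed_matrix_cone_psd[of "m * n", unfolded closed_matrix_cone_def]
  have "X + Y \<in> separable m n" if XY: "X \<in> separable m n" "Y \<in> separable m n" for X Y
  proof -
    from XY have p: "X \<in> psd (m * n)" "Y \<in> psd (m * n)" by (auto simp: separable_iff)
    have "separable_form m n (\<lambda>rs. (X + Y) $$ rs) \<longleftrightarrow> separable_form m n (\<lambda>rs. X $$ rs + Y $$ rs)"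
      using p[THEN psd_carrier] by (intro separable_form_cong) auto
    then show ?thesis using XY psd by (auto simp: separable_iff separable_form_add)
  qed
  moreover have "complex_of_real t \<cdot>\<^sub>m X \<in> separable m n" if X: "X \<in> separable m n" "0 \<le> t" for X t
  proof -
    from X have p: "X \<in> psd (m * n)" by (auto simp: separable_iff)
    have "separable_form m n (\<lambda>rs. (complex_of_real t \<cdot>\<^sub>m X) $$ rs) \<longleftrightarrow>
        separable_form m n (\<lambda>rs. complex_of_real t * X $$ rs)"
      using p[THEN psd_carrier] by (intro separable_form_cong) auto
    then show ?thesis using X psd by (auto simp: separable_iff separable_form_scale)
  qed
  moreover have "0\<^sub>m (m * n) (m * n) \<in> separable m n"
    using psd by (auto simp: separable_iff separable_form_def intro!: exI[of _ "0::nat"])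
  moreover have "{F. mat (m * n) (m * n) F \<in> separable m n} = {F. psd_form (m * n) F} \<inter> {F. separable_form m n F}"
    using separable_form_cong[of m n "\<lambda>rs. mat (m * n) (m * n) F $$ rs" F for F]
    by (auto simp: separable_iff mat_in_psd_iff)
  ultimately show ?thesis
    using psd_carrier closed_psd_form closed_separable_form
    by (auto simp: closed_matrix_cone_def separable_iff)
qed

section \<open>Maps whose ampliation takes values in a cone\<close>

lemma linear_mapsD:
  assumes "\<Phi> \<in> linear_maps d\<^sub>1 d\<^sub>2"
  shows "X \<in> carrier_mat d\<^sub>1 d\<^sub>1 \<Longrightarrow> \<Phi> X \<in> carrier_mat d\<^sub>2 d\<^sub>2"
    and "X \<in> carrier_mat d\<^sub>1 d\<^sub>1 \<Longrightarrow> Y \<in> carrier_mat d\<^sub>1 d\<^sub>1 \<Longrightarrow> \<Phi> (X + Y) = \<Phi> X + \<Phi> Y"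
    and "X \<in> carrier_mat d\<^sub>1 d\<^sub>1 \<Longrightarrow> \<Phi> (c \<cdot>\<^sub>m X) = c \<cdot>\<^sub>m \<Phi> X"
  using assms by (auto simp: linear_maps_def)

lemma linear_map_dims [simp]:
  assumes "\<Phi> \<in> linear_maps d\<^sub>1 d\<^sub>2" "X \<in> carrier_mat d\<^sub>1 d\<^sub>1"
  shows "dim_row (\<Phi> X) = d\<^sub>2" "dim_col (\<Phi> X) = d\<^sub>2"
  using linear_mapsD(1)[OF assms] by auto

lemma block_carrier [simp]: "block n X i j \<in> carrier_mat n n"
  by (simp add: block_def)

lemma ampliation_index:
  assumes "X \<in> carrier_mat (k * d\<^sub>1) (k * d\<^sub>1)" "r < k * d\<^sub>2" "s < k * d\<^sub>2"
  shows "ampliation k d\<^sub>1 d\<^sub>2 \<Phi> X $$ (r, s) =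
    \<Phi> (block d\<^sub>1 X (r div d\<^sub>2) (s div d\<^sub>2)) $$ (r mod d\<^sub>2, s mod d\<^sub>2)"
  using assms by (simp add: ampliation_def)

lemma ampliation_carrier:
  assumes "X \<in> carrier_mat (k * d\<^sub>1) (k * d\<^sub>1)"
  shows "ampliation k d\<^sub>1 d\<^sub>2 \<Phi> X \<in> carrier_mat (k * d\<^sub>2) (k * d\<^sub>2)"
  using assms by (simp add: ampliation_def)

text \<open>
  The common form of all the conditions on maps: \<open>k\<close>-positivity is the case of the positive semidefinite
  cone, and \<open>k\<close>-entanglement breaking that of the separable cone.
\<close>

definition ampliated_into :: "nat \<Rightarrow> nat \<Rightarrow> nat \<Rightarrow> complex mat set \<Rightarrow> (complex mat \<Rightarrow> complex mat) set" where
  "ampliated_into k d\<^sub>1 d\<^sub>2 S =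
     {\<Phi> \<in> linear_maps d\<^sub>1 d\<^sub>2. \<forall>X \<in> psd (k * d\<^sub>1). ampliation k d\<^sub>1 d\<^sub>2 \<Phi> X \<in> S}"

lemma k_positive_maps_eq: "k_positive_maps k d\<^sub>1 d\<^sub>2 = ampliated_into k d\<^sub>1 d\<^sub>2 (psd (k * d\<^sub>2))"
  using ampliation_linear by (auto simp: k_positive_maps_def positive_maps_def ampliated_into_def)

text \<open>
  As separable matrices are positive semidefinite, the two conditions of the definition merge into one.
\<close>

lemma EB_eq: "EB k d\<^sub>1 d\<^sub>2 = ampliated_into k d\<^sub>1 d\<^sub>2 (separable k d\<^sub>2)"
  by (auto simp: EB_def k_positive_maps_eq ampliated_into_def separable_iff)

lemma EBCP_eq:
  "EBCP k d\<^sub>1 d\<^sub>2 = EB k d\<^sub>1 d\<^sub>2 \<inter> (\<Inter>l\<in>{1..}. ampliated_into l d\<^sub>1 d\<^sub>2 (psd (l * d\<^sub>2)))"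
  by (auto simp: EBCP_def CP_maps_def k_positive_maps_eq EB_eq ampliated_into_def)

lemma continuous_map_entry:
  assumes "X \<in> carrier_mat d\<^sub>1 d\<^sub>1" "i < d\<^sub>2" "j < d\<^sub>2"
  shows "continuous_map (linear_maps_topology d\<^sub>1 d\<^sub>2) euclidean (\<lambda>\<Phi>. \<Phi> X $$ (i, j))"
proof -
  define I where "I = (carrier_mat d\<^sub>1 d\<^sub>1 :: complex mat set) \<times> {..<d\<^sub>2} \<times> {..<d\<^sub>2}"
  have mem: "(X, i, j) \<in> I" using assms by (simp add: I_def)
  have "continuous_map (product_topology (\<lambda>_. euclidean) I) euclidean (\<lambda>p. p (X, i, j) :: complex)"
    using mem by (rule continuous_map_product_coordinates)
  from continuous_map_pullback[OF this, of "linear_maps d\<^sub>1 d\<^sub>2" "\<lambda>\<Phi>. \<lambda>(X, i, j) \<in> I. \<Phi> X $$ (i, j)"]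
  show ?thesis using mem by (simp add: linear_maps_topology_def I_def[symmetric] o_def)
qed

lemma topspace_linear_maps_topology: "topspace (linear_maps_topology d\<^sub>1 d\<^sub>2) = linear_maps d\<^sub>1 d\<^sub>2"
  by (auto simp: linear_maps_topology_def topspace_pullback_topology Let_def)

text \<open>
  For each fixed \<open>X\<close> the entries of the ampliation at \<open>X\<close> are entries of \<open>\<Phi>\<close> at blocks of \<open>X\<close>, hence
  continuous in \<open>\<Phi>\<close>. The set is therefore an intersection of preimages of a closed set.
\<close>

lemma closedin_ampliated_into:
  assumes S: "closed_matrix_cone (k * d\<^sub>2) S"
  shows "closedin (linear_maps_topology d\<^sub>1 d\<^sub>2) (ampliated_into k d\<^sub>1 d\<^sub>2 S)"
proof -
  let ?T = "linear_maps_topology d\<^sub>1 d\<^sub>2" and ?n = "k * d\<^sub>2"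
  define E where "E X \<Phi> = (\<lambda>(r, s). if r < ?n \<and> s < ?n then ampliation k d\<^sub>1 d\<^sub>2 \<Phi> X $$ (r, s) else 0)" for X \<Phi>
  have E: "mat ?n ?n (E X \<Phi>) = ampliation k d\<^sub>1 d\<^sub>2 \<Phi> X" if "X \<in> psd (k * d\<^sub>1)" for X \<Phi>
    using ampliation_carrier[OF psd_carrier[OF that], of d\<^sub>2 \<Phi>]
    by (intro eq_matI) (auto simp: E_def)
  have "continuous_map ?T euclidean (E X)" if X: "X \<in> psd (k * d\<^sub>1)" for X
  proof -
    have "continuous_map ?T euclidean (\<lambda>\<Phi>. E X \<Phi> (r, s))" for r s
    proof (cases "r < ?n \<and> s < ?n")
      case True
      then have "continuous_map ?T euclidean (\<lambda>\<Phi>.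
          \<Phi> (block d\<^sub>1 X (r div d\<^sub>2) (s div d\<^sub>2)) $$ (r mod d\<^sub>2, s mod d\<^sub>2))"
        by (intro continuous_map_entry div_mod_less[of _ k]) auto
      then show ?thesis using True
        by (simp add: E_def ampliation_index[OF psd_carrier[OF X]])
    next
      case False
      then have "(\<lambda>\<Phi>. E X \<Phi> (r, s)) = (\<lambda>_. 0)" by (auto simp: E_def)
      then show ?thesis by simp
    qed
    then show ?thesis
      by (simp add: continuous_map_componentwise_UNIV flip: euclidean_product_topology)
  qed
  then have "closedin ?T {\<Phi> \<in> topspace ?T. E X \<Phi> \<in> {F. mat ?n ?n F \<in> S}}" if "X \<in> psd (k * d\<^sub>1)" for X
    using S that by (intro closedin_continuous_map_preimage[of _ euclidean]) (auto simp: closed_matrix_cone_def)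
  then have "closedin ?T (\<Inter>X\<in>psd (k * d\<^sub>1). {\<Phi> \<in> topspace ?T. E X \<Phi> \<in> {F. mat ?n ?n F \<in> S}})"
    using closed_matrix_cone_psd[of "k * d\<^sub>1"]
    by (intro closedin_INT) (auto simp: closed_matrix_cone_def)
  also have "(\<Inter>X\<in>psd (k * d\<^sub>1). {\<Phi> \<in> topspace ?T. E X \<Phi> \<in> {F. mat ?n ?n F \<in> S}}) = ampliated_into k d\<^sub>1 d\<^sub>2 S"
    using closed_matrix_cone_psd[of "k * d\<^sub>1"]
    by (auto simp: ampliated_into_def topspace_linear_maps_topology E closed_matrix_cone_def)
  finally show ?thesis .
qed

text \<open>
  A cone described by the zero map, sums and multiples: each of the three conditions visibly passes to
  intersections, and together they imply \<^const>\<open>convex_cone_of_maps\<close>.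
\<close>

definition map_cone :: "nat \<Rightarrow> nat \<Rightarrow> (complex mat \<Rightarrow> complex mat) set \<Rightarrow> bool" where
  "map_cone d\<^sub>1 d\<^sub>2 C \<longleftrightarrow> (\<lambda>X\<in>carrier_mat d\<^sub>1 d\<^sub>1. 0\<^sub>m d\<^sub>2 d\<^sub>2) \<in> C \<and>
     (\<forall>\<Phi>\<in>C. \<forall>\<Psi>\<in>C. linmap_add d\<^sub>1 \<Phi> \<Psi> \<in> C) \<and> (\<forall>t\<ge>0. \<forall>\<Phi>\<in>C. linmap_scale d\<^sub>1 t \<Phi> \<in> C)"

lemma convex_cone_of_maps_if_map_cone: "map_cone d\<^sub>1 d\<^sub>2 C \<Longrightarrow> convex_cone_of_maps d\<^sub>1 C"
  unfolding map_cone_def convex_cone_of_maps_def by blast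

lemma map_cone_Int: "map_cone d\<^sub>1 d\<^sub>2 C \<Longrightarrow> map_cone d\<^sub>1 d\<^sub>2 D \<Longrightarrow> map_cone d\<^sub>1 d\<^sub>2 (C \<inter> D)"
  by (simp add: map_cone_def)

lemma map_cone_INT: "(\<And>i. i \<in> I \<Longrightarrow> map_cone d\<^sub>1 d\<^sub>2 (C i)) \<Longrightarrow> map_cone d\<^sub>1 d\<^sub>2 (\<Inter>i\<in>I. C i)"
  by (simp add: map_cone_def)

lemma map_cone_linear_maps: "map_cone d\<^sub>1 d\<^sub>2 (linear_maps d\<^sub>1 d\<^sub>2)"
proof -
  have "linmap_add d\<^sub>1 \<Phi> \<Psi> \<in> linear_maps d\<^sub>1 d\<^sub>2" if L: "\<Phi> \<in> linear_maps d\<^sub>1 d\<^sub>2" "\<Psi> \<in> linear_maps d\<^sub>1 d\<^sub>2" for \<Phi> \<Psi>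
    unfolding linear_maps_def
    using L by (auto simp: linmap_add_def linear_mapsD[OF L(1)] linear_mapsD[OF L(2)]
        algebra_simps intro!: eq_matI)
  moreover have "linmap_scale d\<^sub>1 t \<Phi> \<in> linear_maps d\<^sub>1 d\<^sub>2" if L: "\<Phi> \<in> linear_maps d\<^sub>1 d\<^sub>2" for \<Phi> t
    unfolding linear_maps_def
    using L by (auto simp: linmap_scale_def linear_mapsD[OF L] algebra_simps intro!: eq_matI)
  moreover have "(\<lambda>X\<in>carrier_mat d\<^sub>1 d\<^sub>1. 0\<^sub>m d\<^sub>2 d\<^sub>2) \<in> linear_maps d\<^sub>1 d\<^sub>2"
    by (auto simp: linear_maps_def)
  ultimately show ?thesis by (simp add: map_cone_def)
qed

lemma map_cone_ampliated_into:
  assumes S: "closed_matrix_cone (k * d\<^sub>2) S"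
  shows "map_cone d\<^sub>1 d\<^sub>2 (ampliated_into k d\<^sub>1 d\<^sub>2 S)"
proof -
  have add: "ampliation k d\<^sub>1 d\<^sub>2 (linmap_add d\<^sub>1 \<Phi> \<Psi>) X = ampliation k d\<^sub>1 d\<^sub>2 \<Phi> X + ampliation k d\<^sub>1 d\<^sub>2 \<Psi> X"
    if "\<Phi> \<in> linear_maps d\<^sub>1 d\<^sub>2" "\<Psi> \<in> linear_maps d\<^sub>1 d\<^sub>2" "X \<in> carrier_mat (k * d\<^sub>1) (k * d\<^sub>1)" for \<Phi> \<Psi> X
    using that by (intro eq_matI) (auto simp: ampliation_def linmap_add_def div_mod_less)
  have scale: "ampliation k d\<^sub>1 d\<^sub>2 (linmap_scale d\<^sub>1 t \<Phi>) X = complex_of_real t \<cdot>\<^sub>m ampliation k d\<^sub>1 d\<^sub>2 \<Phi> X"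
    if "\<Phi> \<in> linear_maps d\<^sub>1 d\<^sub>2" "X \<in> carrier_mat (k * d\<^sub>1) (k * d\<^sub>1)" for \<Phi> t X
    using that by (intro eq_matI) (auto simp: ampliation_def linmap_scale_def div_mod_less)
  have zero: "ampliation k d\<^sub>1 d\<^sub>2 (\<lambda>X\<in>carrier_mat d\<^sub>1 d\<^sub>1. 0\<^sub>m d\<^sub>2 d\<^sub>2) X = 0\<^sub>m (k * d\<^sub>2) (k * d\<^sub>2)"
    if "X \<in> carrier_mat (k * d\<^sub>1) (k * d\<^sub>1)" for X
    using that by (intro eq_matI) (auto simp: ampliation_def div_mod_less)
  show ?thesis
    using S map_cone_linear_maps[of d\<^sub>1 d\<^sub>2]
    by (auto simp: map_cone_def ampliated_into_def closed_matrix_cone_def add scale zero psd_carrier)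
qed

section \<open>Composition\<close>

text \<open>
  A positive semidefinite \<open>X\<close> is placed as the block \<open>(0, 0)\<close> of a matrix that is zero elsewhere. The block
  \<open>(0, 0)\<close> of its image is \<open>\<Phi> X\<close>, a principal submatrix of a positive semidefinite matrix.
\<close>

lemma k_positive_imp_positive:
  assumes k: "k \<ge> 1" and \<Phi>: "\<Phi> \<in> k_positive_maps k d\<^sub>1 d\<^sub>2"
  shows "\<Phi> \<in> positive_maps d\<^sub>1 d\<^sub>2"
proof -
  have L: "\<Phi> \<in> linear_maps d\<^sub>1 d\<^sub>2" using \<Phi> by (simp add: k_positive_maps_def)
  have le: "d \<le> k * d" for d using k by simp
  have lt: "a < k * d" if "a < d" for a d using less_le_trans[OF that le[of d]] .
  have "\<Phi> X \<in> psd d\<^sub>2" if X: "X \<in> psd d\<^sub>1" for X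
  proof -
    define Y where "Y = mat (k * d\<^sub>1) (k * d\<^sub>1) (\<lambda>(r, s). if r < d\<^sub>1 \<and> s < d\<^sub>1 then X $$ (r, s) else 0)"
    have "Y \<in> psd (k * d\<^sub>1)"
      unfolding Y_def mat_in_psd_iff psd_form_def
    proof
      fix z
      have "(\<Sum>i<k*d\<^sub>1. \<Sum>j<k*d\<^sub>1. (case (i, j) of (r, s) \<Rightarrow> if r < d\<^sub>1 \<and> s < d\<^sub>1 then X $$ (r, s) else 0) * z j * cnj (z i))
          = (\<Sum>i<d\<^sub>1. \<Sum>j<d\<^sub>1. X $$ (i, j) * z j * cnj (z i))"
        using le[of d\<^sub>1] by (intro sum.mono_neutral_cong_right sum.neutral) auto
      then show "0 \<le> (\<Sum>i<k*d\<^sub>1. \<Sum>j<k*d\<^sub>1. (case (i, j) of (r, s) \<Rightarrow> if r < d\<^sub>1 \<and> s < d\<^sub>1 then X $$ (r, s) else 0) * z j * cnj (z i))"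
        using X by (simp add: psd_iff_psd_form psd_form_def)
    qed
    then have Z: "ampliation k d\<^sub>1 d\<^sub>2 \<Phi> Y \<in> psd (k * d\<^sub>2)"
      using \<Phi> by (auto simp: k_positive_maps_def positive_maps_def)
    have "block d\<^sub>1 Y 0 0 = X"
      using psd_carrier[OF X] by (intro eq_matI) (auto simp: block_def Y_def lt)
    then have "ampliation k d\<^sub>1 d\<^sub>2 \<Phi> Y $$ (a, b) = \<Phi> X $$ (a, b)" if "a < d\<^sub>2" "b < d\<^sub>2" for a b
      using that by (subst ampliation_index) (auto simp: Y_def lt)
    moreover have "psd_form d\<^sub>2 (\<lambda>(a, b). ampliation k d\<^sub>1 d\<^sub>2 \<Phi> Y $$ (a, b))"
      using Z le[of d\<^sub>2] psd_form_principal[of "k * d\<^sub>2" "\<lambda>rs. ampliation k d\<^sub>1 d\<^sub>2 \<Phi> Y $$ rs" "\<lambda>a. a" d\<^sub>2]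
      by (auto simp: psd_iff_psd_form)
    ultimately have "psd_form d\<^sub>2 (\<lambda>rs. \<Phi> X $$ rs)"
      by (subst psd_form_cong[of _ _ "\<lambda>(a, b). ampliation k d\<^sub>1 d\<^sub>2 \<Phi> Y $$ (a, b)"]) auto
    then show ?thesis using linear_mapsD(1)[OF L psd_carrier[OF X]] by (simp add: psd_iff_psd_form)
  qed
  then show ?thesis using L by (simp add: positive_maps_def)
qed

lemma linear_maps_compose:
  assumes "\<Phi> \<in> linear_maps d\<^sub>2 d\<^sub>3" "\<Psi> \<in> linear_maps d\<^sub>1 d\<^sub>2"
  shows "compose (carrier_mat d\<^sub>1 d\<^sub>1) \<Phi> \<Psi> \<in> linear_maps d\<^sub>1 d\<^sub>3"
  unfolding linear_maps_def
  by (auto simp: compose_def linear_mapsD[OF assms(1)] linear_mapsD[OF assms(2)])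

lemma ampliation_compose:
  assumes "\<Phi> \<in> linear_maps d\<^sub>2 d\<^sub>3" "\<Psi> \<in> linear_maps d\<^sub>1 d\<^sub>2" "X \<in> carrier_mat (k * d\<^sub>1) (k * d\<^sub>1)"
  shows "ampliation k d\<^sub>1 d\<^sub>3 (compose (carrier_mat d\<^sub>1 d\<^sub>1) \<Phi> \<Psi>) X =
    ampliation k d\<^sub>2 d\<^sub>3 \<Phi> (ampliation k d\<^sub>1 d\<^sub>2 \<Psi> X)"
proof -
  have "block d\<^sub>2 (ampliation k d\<^sub>1 d\<^sub>2 \<Psi> X) i j = \<Psi> (block d\<^sub>1 X i j)" if "i < k" "j < k" for i j
    using assms that
    by (intro eq_matI) (auto simp: block_def[of d\<^sub>2] ampliation_index index_less_mult)
  then show ?thesis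
    using assms ampliation_carrier[OF assms(3), of d\<^sub>2 \<Psi>]
    by (intro eq_matI) (auto simp: ampliation_def[of k d\<^sub>1 d\<^sub>3] ampliation_def[of k d\<^sub>2 d\<^sub>3] compose_def div_mod_less)
qed

lemma linear_map_sum:
  assumes L: "L \<in> linear_maps n n'" and T: "\<And>l. l < N \<Longrightarrow> T l \<in> carrier_mat n n"
  shows "L (mat n n (\<lambda>rs. \<Sum>l<(N::nat). T l $$ rs)) = mat n' n' (\<lambda>rs. \<Sum>l<N. L (T l) $$ rs)"
  using T
proof (induction N)
  case 0
  have "L (0\<^sub>m n n) = L (0 \<cdot>\<^sub>m 0\<^sub>m n n)" by (rule arg_cong[of _ _ L]) auto
  also have "\<dots> = 0 \<cdot>\<^sub>m L (0\<^sub>m n n)" by (rule linear_mapsD(3)[OF L]) simp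
  also have "\<dots> = 0\<^sub>m n' n'" using L by (intro eq_matI) auto
  finally show ?case by (simp add: zero_mat_def)
next
  case (Suc N)
  have "mat n n (\<lambda>rs. \<Sum>l<Suc N. T l $$ rs) = mat n n (\<lambda>rs. \<Sum>l<N. T l $$ rs) + T N"
    using Suc.prems[of N] by (intro eq_matI) auto
  then have "L (mat n n (\<lambda>rs. \<Sum>l<Suc N. T l $$ rs)) = L (mat n n (\<lambda>rs. \<Sum>l<N. T l $$ rs)) + L (T N)"
    using linear_mapsD(2)[OF L] Suc.prems[of N] by simp
  also have "\<dots> = mat n' n' (\<lambda>rs. \<Sum>l<Suc N. L (T l) $$ rs)"
    using Suc linear_mapsD(1)[OF L Suc.prems[of N]] by (intro eq_matI) auto
  finally show ?case .
qed

text \<open>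
  The ampliation of \<open>\<Phi>\<close> sends \<open>A \<otimes> B\<close> to \<open>A \<otimes> \<Phi> B\<close>, and \<open>\<Phi>\<close> is positive.
\<close>

lemma ampliation_separable:
  assumes k: "k \<ge> 1" and \<Phi>: "\<Phi> \<in> k_positive_maps k d\<^sub>1 d\<^sub>2" and X: "X \<in> separable k d\<^sub>1"
  shows "ampliation k d\<^sub>1 d\<^sub>2 \<Phi> X \<in> separable k d\<^sub>2"
proof -
  have pos: "\<Phi> \<in> positive_maps d\<^sub>1 d\<^sub>2" using k_positive_imp_positive[OF k \<Phi>] .
  then have L: "\<Phi> \<in> linear_maps d\<^sub>1 d\<^sub>2" by (simp add: positive_maps_def)
  obtain N A B where N: "X \<in> psd (k * d\<^sub>1)" "\<And>l. l < N \<Longrightarrow> A l \<in> psd k \<and> B l \<in> psd d\<^sub>1"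
    "X = mat (k * d\<^sub>1) (k * d\<^sub>1) (\<lambda>rs. \<Sum>l<(N::nat). tensor_mat (A l) (B l) $$ rs)"
    using X unfolding separable_def by blast
  have "tensor_mat (A l) (B l) \<in> carrier_mat (k * d\<^sub>1) (k * d\<^sub>1)" if "l < N" for l
    using N(2)[OF that] by (auto simp: tensor_mat_def dest!: psd_carrier)
  then have "ampliation k d\<^sub>1 d\<^sub>2 \<Phi> X =
      mat (k * d\<^sub>2) (k * d\<^sub>2) (\<lambda>rs. \<Sum>l<N. ampliation k d\<^sub>1 d\<^sub>2 \<Phi> (tensor_mat (A l) (B l)) $$ rs)"
    unfolding N(3) by (intro linear_map_sum ampliation_linear L)
  also have "\<dots> = mat (k * d\<^sub>2) (k * d\<^sub>2) (\<lambda>rs. \<Sum>l<N. tensor_mat (A l) (\<Phi> (B l)) $$ rs)"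
    using N(2) by (simp add: ampliation_tensor[OF L] psd_carrier)
  finally have "ampliation k d\<^sub>1 d\<^sub>2 \<Phi> X =
      mat (k * d\<^sub>2) (k * d\<^sub>2) (\<lambda>rs. \<Sum>l<N. tensor_mat (A l) (\<Phi> (B l)) $$ rs)" .
  moreover have "\<forall>l<N. A l \<in> psd k \<and> \<Phi> (B l) \<in> psd d\<^sub>2"
    using N(2) pos by (auto simp: positive_maps_def)
  moreover have "ampliation k d\<^sub>1 d\<^sub>2 \<Phi> X \<in> psd (k * d\<^sub>2)"
    using \<Phi> N(1) by (auto simp: k_positive_maps_def positive_maps_def)
  ultimately show ?thesis unfolding separable_def
    by (intro CollectI conjI exI[of _ N] exI[of _ A] exI[of _ "\<lambda>l. \<Phi> (B l)"])
qed

lemma k_positive_compose: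
  assumes "\<Phi> \<in> k_positive_maps k d\<^sub>2 d\<^sub>3" "\<Psi> \<in> k_positive_maps k d\<^sub>1 d\<^sub>2"
  shows "compose (carrier_mat d\<^sub>1 d\<^sub>1) \<Phi> \<Psi> \<in> k_positive_maps k d\<^sub>1 d\<^sub>3"
  using assms
  by (auto simp: k_positive_maps_eq ampliated_into_def linear_maps_compose ampliation_compose psd_carrier)

text \<open>
  The ampliation of the composition is the composition of the ampliations: \<open>\<Psi>\<close> keeps the argument positive
  semidefinite, \<open>\<Theta>\<close> makes it separable, and \<open>\<Phi>\<close> preserves separability.
\<close>

lemma EB_compose_k_positive:
  assumes k: "k \<ge> 1" and \<Theta>: "\<Theta> \<in> EB k d\<^sub>1 d\<^sub>2"
    and \<Psi>: "\<Psi> \<in> k_positive_maps k d d\<^sub>1" and \<Phi>: "\<Phi> \<in> k_positive_maps k d\<^sub>2 d'"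
  shows "compose (carrier_mat d d) \<Phi> (compose (carrier_mat d d) \<Theta> \<Psi>) \<in> EB k d d'"
  using assms ampliation_separable[OF k \<Phi>]
  by (auto simp: EB_eq k_positive_maps_eq ampliated_into_def linear_maps_compose ampliation_compose psd_carrier)

theorem theorem3p12:
  fixes d\<^sub>1 d\<^sub>2 k :: nat
  assumes "d\<^sub>1 \<ge> 1" and "d\<^sub>2 \<ge> 1" and "k \<ge> 1"
  shows "mapping_cone d\<^sub>1 d\<^sub>2 (EB k d\<^sub>1 d\<^sub>2) \<and> mapping_cone d\<^sub>1 d\<^sub>2 (EBCP k d\<^sub>1 d\<^sub>2)"
proof -
  have pos: "EB k d\<^sub>1 d\<^sub>2 \<subseteq> positive_maps d\<^sub>1 d\<^sub>2"
    using k_positive_imp_positive[OF \<open>k \<ge> 1\<close>] by (auto simp: EB_def)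
  have closed: "closedin (linear_maps_topology d\<^sub>1 d\<^sub>2) (EB k d\<^sub>1 d\<^sub>2)"
    unfolding EB_eq by (intro closedin_ampliated_into closed_matrix_cone_separable)
  have cone: "map_cone d\<^sub>1 d\<^sub>2 (EB k d\<^sub>1 d\<^sub>2)"
    unfolding EB_eq by (intro map_cone_ampliated_into closed_matrix_cone_separable)
  have closed_CP: "closedin (linear_maps_topology d\<^sub>1 d\<^sub>2) (EBCP k d\<^sub>1 d\<^sub>2)"
    unfolding EBCP_eq
    by (intro closedin_Int closed closedin_INT closedin_ampliated_into closed_matrix_cone_psd) auto
  have cone_CP: "map_cone d\<^sub>1 d\<^sub>2 (EBCP k d\<^sub>1 d\<^sub>2)"
    unfolding EBCP_eq
    by (intro map_cone_Int cone map_cone_INT map_cone_ampliated_into closed_matrix_cone_psd)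
  have comp: "compose (carrier_mat d\<^sub>1 d\<^sub>1) \<Phi> (compose (carrier_mat d\<^sub>1 d\<^sub>1) \<Theta> \<Psi>) \<in> EB k d\<^sub>1 d\<^sub>2"
    if "\<Theta> \<in> EB k d\<^sub>1 d\<^sub>2" "\<Psi> \<in> CP_maps d\<^sub>1 d\<^sub>1" "\<Phi> \<in> CP_maps d\<^sub>2 d\<^sub>2" for \<Theta> \<Psi> \<Phi>
    using that assms by (intro EB_compose_k_positive[of k]) (auto simp: CP_maps_def)
  have comp_CP: "compose (carrier_mat d\<^sub>1 d\<^sub>1) \<Phi> (compose (carrier_mat d\<^sub>1 d\<^sub>1) \<Theta> \<Psi>) \<in> CP_maps d\<^sub>1 d\<^sub>2"
    if "\<Theta> \<in> CP_maps d\<^sub>1 d\<^sub>2" "\<Psi> \<in> CP_maps d\<^sub>1 d\<^sub>1" "\<Phi> \<in> CP_maps d\<^sub>2 d\<^sub>2" for \<Theta> \<Psi> \<Phi>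
    using that by (auto simp: CP_maps_def intro!: k_positive_compose linear_maps_compose)
  show ?thesis
    using pos closed cone closed_CP cone_CP comp comp_CP convex_cone_of_maps_if_map_cone
    unfolding mapping_cone_def by (auto simp: EBCP_def)
qed

end
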